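(* For any $(\alpha,\alpha')\in\mathbb{R}^n\times\mathbb{R}$, $$\max\{\alpha^{\top}x+\alpha' y:(x,y)\in\operatorname{conv}(G)\}=\max_{k=0,\dots,n}\left\{u\sum_{j=1}^{k}\alpha_{\sigma(j)}+\ell\sum_{j=k+1}^{n}\alpha_{\sigma(j)}+\alpha' m(x^k)\right\},$$ where $\sigma$ is a permutation of $\{1,\dots,n\}$ such that $\alpha_{\sigma(1)}\ge\alpha_{\sigma(2)}\ge\cdots\ge\alpha_{\sigma(n)}$.
   Context: Let $n\ge 2$, $N=\{1,\dots,n\}$, and let $\ell<u$ be real numbers. Let $X=\{x\in\mathbb{R}^n:\ell\le x_j\le u,\ j\in N\}$. For real coefficients $c_2,\dots,c_n$ let $m(x)=\sum_{i=2}^n c_i\sum_{J\subseteq N,\ |J|=i}\prod_{j\in J}x_j$, and let $G=\{(x,y)\in\mathbb{R}^n\times\mathbb{R}: x\in X,\ y=m(x)\}$, with convex hull $\operatorname{conv}(G)$. For $k=0,\dots,n$, $x^k\in\mathbb{R}^n$ denotes the vector whose first $k$ entries equal $u$ and whose last $n-k$ entries equal $\ell$. Empty sums are $0$. *)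

theory Defs
  imports "HOL-Analysis.Analysis"
begin

text \<open>
  The index set \<open>N = {1,...,n}\<close> is a finite linearly ordered type \<open>'n\<close> with \<open>n = CARD('n)\<close>;
  the order on \<open>'n\<close> plays the role of the order of the labels \<open>1 < ... < n\<close>.
\<close>

definition box_set :: "real \<Rightarrow> real \<Rightarrow> (real ^ 'n) set" where
  "box_set l u = {x. \<forall>j. l \<le> x $ j \<and> x $ j \<le> u}"

definition m_fun :: "(nat \<Rightarrow> real) \<Rightarrow> real ^ 'n \<Rightarrow> real" where
  "m_fun c x = (\<Sum>i = 2..CARD('n). c i * (\<Sum>J | J \<subseteq> (UNIV :: 'n set) \<and> card J = i. \<Prod>j\<in>J. x $ j))"

definition graph_set :: "real \<Rightarrow> real \<Rightarrow> (nat \<Rightarrow> real) \<Rightarrow> ((real ^ 'n) \<times> real) set" where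
  "graph_set l u c = {(x, y). x \<in> box_set l u \<and> y = m_fun c x}"

text \<open>
  An index \<open>j\<close> with \<open>p\<close> strict predecessors carries the label \<open>p + 1\<close>, so this is the
  counterpart of \<open>{1,...,k}\<close>, and its complement that of \<open>{k+1,...,n}\<close>.
\<close>

definition first_indices :: "nat \<Rightarrow> 'n :: {finite, linorder} set" where
  "first_indices k = {j. card {i. i < j} < k}"

definition xk :: "real \<Rightarrow> real \<Rightarrow> nat \<Rightarrow> real ^ 'n :: {finite, linorder}" where
  "xk l u k = (\<chi> j. if j \<in> first_indices k then u else l)"

text \<open>Attained maximum of a possibly infinite set (the library's \<open>Max\<close> is only meaningful for finite sets).\<close>

definition is_maximum :: "real set \<Rightarrow> real \<Rightarrow> bool" where
  "is_maximum S v \<longleftrightarrow> v \<in> S \<and> (\<forall>s\<in>S. s \<le> v)"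

end

theory Submission
  imports Defs
begin

text \<open>
  The linear functional \<open>(x, y) \<mapsto> \<alpha> \<bullet> x + \<alpha>' y\<close> takes no larger values on the convex hull of the
  graph than on the graph itself, where it is the function \<open>F x = \<alpha> \<bullet> x + \<alpha>' m(x)\<close> on the box.
  Every monomial of \<open>m\<close> is square-free, so \<open>F\<close> is affine in each coordinate separately; moving the
  coordinates one after the other to a suitable end of \<open>[l, u]\<close> never decreases \<open>F\<close>
  (\<open>multiaffine_le_vertex\<close>), and only the vertices of the box matter.

  A vertex is given by the set \<open>S\<close> of coordinates equal to \<open>u\<close>. As \<open>m\<close> is symmetric, its value there
  depends on \<open>k = card S\<close> alone and equals \<open>m(x\<^sup>k)\<close> (\<open>m_fun_vertex\<close>). For fixed \<open>k\<close> it remains to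
  maximize \<open>\<alpha> \<bullet> x\<close>, which, because of \<open>l < u\<close>, means to maximize the sum of \<open>\<alpha>\<close> over \<open>S\<close>; the \<open>k\<close>
  largest coefficients, those at the positions \<open>\<sigma>(1), ..., \<sigma>(k)\<close>, are optimal
  (\<open>sum_le_sum_first_indices\<close>). The same vertices lie on the graph, so that the maximum is attained.
\<close>

section \<open>Functions affine in each coordinate\<close>

definition multiaffine :: "(real ^ 'n \<Rightarrow> real) \<Rightarrow> bool" where
  "multiaffine f \<longleftrightarrow> (\<forall>x j. \<exists>a b. \<forall>t. f (\<chi> i. if i = j then t else x $ i) = a + b * t)"

lemma multiaffine_const: "multiaffine (\<lambda>x. d)"
  unfolding multiaffine_def by (metis add.right_neutral mult_zero_left)

lemma multiaffine_add:
  assumes "multiaffine f" "multiaffine g"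
  shows "multiaffine (\<lambda>x. f x + g x)"
  unfolding multiaffine_def
proof (intro allI)
  fix x j
  obtain a b where "\<And>t. f (\<chi> i. if i = j then t else x $ i) = a + b * t"
    using assms(1) unfolding multiaffine_def by metis
  moreover obtain a' b' where "\<And>t. g (\<chi> i. if i = j then t else x $ i) = a' + b' * t"
    using assms(2) unfolding multiaffine_def by metis
  ultimately have "\<forall>t. f (\<chi> i. if i = j then t else x $ i) + g (\<chi> i. if i = j then t else x $ i)
      = (a + a') + (b + b') * t"
    by (simp add: algebra_simps)
  then show "\<exists>a b. \<forall>t. f (\<chi> i. if i = j then t else x $ i) + g (\<chi> i. if i = j then t else x $ i)
      = a + b * t"
    by blast
qed

lemma multiaffine_cmult:
  assumes "multiaffine f"
  shows "multiaffine (\<lambda>x. d * f x)"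
  unfolding multiaffine_def
proof (intro allI)
  fix x j
  obtain a b where "\<And>t. f (\<chi> i. if i = j then t else x $ i) = a + b * t"
    using assms unfolding multiaffine_def by metis
  then have "\<forall>t. d * f (\<chi> i. if i = j then t else x $ i) = d * a + (d * b) * t"
    by (simp add: algebra_simps)
  then show "\<exists>a b. \<forall>t. d * f (\<chi> i. if i = j then t else x $ i) = a + b * t"
    by blast
qed

lemma multiaffine_sum:
  assumes "\<And>i. i \<in> I \<Longrightarrow> multiaffine (f i)"
  shows "multiaffine (\<lambda>x. \<Sum>i\<in>I. f i x)"
  using assms
  by (induction I rule: infinite_finite_induct) (auto intro: multiaffine_const multiaffine_add)

text \<open>This is where square-freeness enters: a coordinate occurs in the product at most once.\<close>

lemma multiaffine_monomial:
  fixes J :: "'n::finite set"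
  shows "multiaffine (\<lambda>x. \<Prod>j\<in>J. x $ j)"
  unfolding multiaffine_def
proof (intro allI)
  fix x :: "real ^ 'n" and j
  let ?P = "\<lambda>t. \<Prod>i\<in>J. (\<chi> i. if i = j then t else x $ i) $ i"
  have off: "(\<Prod>i\<in>J - {j}. if i = j then t else x $ i) = (\<Prod>i\<in>J - {j}. x $ i)" for t
    by (rule prod.cong) auto
  show "\<exists>a b. \<forall>t. ?P t = a + b * t"
  proof (cases "j \<in> J")
    case True
    then have "?P t = 0 + (\<Prod>i\<in>J - {j}. x $ i) * t" for t
      by (simp add: prod.remove[of J j] off)
    then show ?thesis by blast
  next
    case False
    then have "?P t = (\<Prod>i\<in>J. x $ i) + 0 * t" for t
      using off by simp
    then show ?thesis by blast
  qed
qed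

lemma multiaffine_inner: "multiaffine (\<lambda>x. \<alpha> \<bullet> x)"
proof -
  have "multiaffine (\<lambda>x. \<Sum>i\<in>UNIV. \<alpha> $ i * (\<Prod>j\<in>{i}. x $ j))"
    by (intro multiaffine_sum multiaffine_cmult multiaffine_monomial)
  then show ?thesis
    by (simp add: inner_vec_def)
qed

lemma multiaffine_m_fun: "multiaffine (m_fun c)"
  unfolding m_fun_def
  by (intro multiaffine_sum multiaffine_cmult multiaffine_monomial)

text \<open>
  An affine function on \<open>[l, u]\<close> is largest at one of the two ends, so the coordinates can be pushed
  to the ends one at a time, without disturbing those already there.
\<close>

lemma multiaffine_le_vertex:
  fixes f :: "real ^ 'n \<Rightarrow> real"
  assumes f: "multiaffine f" and x: "x \<in> box_set l u"
  obtains S where "f x \<le> f (\<chi> j. if j \<in> S then u else l)"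
proof -
  have "\<exists>y\<in>box_set l u. f x \<le> f y \<and> (\<forall>j\<in>A. y $ j = l \<or> y $ j = u)" for A :: "'n set"
    using finite[of A]
  proof (induction A rule: finite_induct)
    case empty
    then show ?case using x by auto
  next
    case (insert j A)
    then obtain y where y: "y \<in> box_set l u" "f x \<le> f y" "\<forall>i\<in>A. y $ i = l \<or> y $ i = u"
      by blast
    define z where "z t = (\<chi> i. if i = j then t else y $ i)" for t
    obtain a b where ab: "\<And>t. f (z t) = a + b * t"
      using f unfolding multiaffine_def z_def by metis
    have "z (y $ j) = y"
      by (simp add: z_def vec_eq_iff)
    then have fy: "f y = a + b * y $ j"
      using ab[of "y $ j"] by simp
    have lu: "l \<le> y $ j" "y $ j \<le> u"
      using y(1) by (auto simp: box_set_def)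
    define t where "t = (if b \<ge> 0 then u else l)"
    have t: "t = l \<or> t = u" "f y \<le> f (z t)"
      using lu by (simp_all add: t_def fy ab mult_left_mono mult_left_mono_neg)
    have "z t \<in> box_set l u" "\<forall>i\<in>insert j A. z t $ i = l \<or> z t $ i = u"
      using t(1) y lu by (auto simp: box_set_def z_def)
    then show ?case
      using t(2) y(2) by (meson order_trans)
  qed
  then obtain y where "f x \<le> f y" and y: "\<forall>j\<in>UNIV. y $ j = l \<or> y $ j = u"
    by blast
  moreover have "y = (\<chi> j. if j \<in> {j. y $ j = u} then u else l)"
    using y by (auto simp: vec_eq_iff)
  ultimately show ?thesis
    using that by metis
qed

section \<open>Initial segments of the index set\<close>

text \<open>Counting predecessors numbers the indices \<open>0, ..., n - 1\<close> bijectively.\<close>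

lemma card_first_indices:
  assumes "k \<le> CARD('n::{finite, linorder})"
  shows "card (first_indices k :: 'n set) = k"
proof -
  define rank where "rank j = card {i. i < j}" for j :: 'n
  have less: "rank i < rank j" if "i < j" for i j
    unfolding rank_def using that by (intro psubset_card_mono) auto
  then have inj: "inj rank"
    by (metis injI linorder_neqE order_less_irrefl)
  have "rank j < CARD('n)" for j
    unfolding rank_def by (intro psubset_card_mono) auto
  then have "range rank = {..<CARD('n)}"
    using inj by (intro card_subset_eq) (auto simp: card_image)
  moreover have "first_indices k = rank -` {..<k}"
    by (auto simp: first_indices_def rank_def)
  ultimately have "rank ` first_indices k = {..<k}"
    using assms by (auto simp: image_vimage_eq)
  then show ?thesis
    using card_image[OF inj_on_subset[OF inj subset_UNIV], of "first_indices k"] by simp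
qed

lemma first_indices_less:
  fixes i j :: "'n::{finite, linorder}"
  assumes "i \<in> first_indices k" "j \<notin> first_indices k"
  shows "i < j"
proof (rule ccontr)
  assume "\<not> i < j"
  then have "card {h. h < j} \<le> card {h. h < i}"
    by (intro card_mono) auto
  with assms show False
    by (simp add: first_indices_def)
qed

text \<open>
  Exchange argument: outside the common part, \<open>T\<close> and the initial segment have equally many elements,
  and each of those in \<open>T\<close> comes after each of those in the segment.
\<close>

lemma sum_le_sum_first_indices:
  fixes \<beta> :: "'n::{finite, linorder} \<Rightarrow> real"
  assumes anti: "\<And>i j. i \<le> j \<Longrightarrow> \<beta> j \<le> \<beta> i"
  shows "sum \<beta> T \<le> sum \<beta> (first_indices (card T))"
proof -
  let ?F = "first_indices (card T) :: 'n set"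
  have "card ?F = card T"
    by (simp add: card_first_indices card_mono)
  then have "card (T - ?F) = card (?F - T)"
    by (simp add: card_Diff_subset_Int Int_commute)
  then obtain h where h: "bij_betw h (T - ?F) (?F - T)"
    by (metis finite finite_same_card_bij)
  have "sum \<beta> (T - ?F) \<le> (\<Sum>j\<in>T - ?F. \<beta> (h j))"
  proof (rule sum_mono)
    fix j assume "j \<in> T - ?F"
    then have "h j \<in> ?F" "j \<notin> ?F"
      using bij_betwE[OF h] by auto
    then show "\<beta> j \<le> \<beta> (h j)"
      by (intro anti less_imp_le first_indices_less)
  qed
  also have "\<dots> = sum \<beta> (?F - T)"
    by (rule sum.reindex_bij_betw[OF h])
  finally show ?thesis
    using sum.Int_Diff[of T \<beta> ?F] sum.Int_Diff[of ?F \<beta> T] by (simp add: Int_commute)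
qed

section \<open>The objective at the vertices of the box\<close>

text \<open>\<open>m\<close> is a combination of elementary symmetric polynomials.\<close>

lemma m_fun_permute:
  fixes x :: "real ^ 'n" and \<tau> :: "'n \<Rightarrow> 'n"
  assumes "bij \<tau>"
  shows "m_fun c (\<chi> j. x $ \<tau> j) = m_fun c x"
proof -
  have inj: "inj_on \<tau> J" for J
    using assms by (auto simp: bij_def intro: inj_on_subset)
  have "(\<Sum>J | J \<subseteq> UNIV \<and> card J = i. \<Prod>j\<in>J. x $ \<tau> j)
      = (\<Sum>J | J \<subseteq> UNIV \<and> card J = i. \<Prod>j\<in>J. x $ j)" for i
  proof (rule sum.reindex_bij_witness[where i = "\<lambda>J. inv \<tau> ` J" and j = "\<lambda>J. \<tau> ` J"])
    show "\<tau> ` inv \<tau> ` J = J" for J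
      using assms by (simp add: bij_is_surj image_f_inv_f)
    show "inv \<tau> ` \<tau> ` J = J" for J
      using assms by (simp add: bij_is_inj image_inv_f_f)
    show "(\<Prod>j\<in>\<tau> ` J. x $ j) = (\<Prod>j\<in>J. x $ \<tau> j)" for J
      by (simp add: prod.reindex[OF inj])
    show "\<tau> ` J \<in> {J. J \<subseteq> UNIV \<and> card J = i}" if "J \<in> {J. J \<subseteq> UNIV \<and> card J = i}" for J
      using that by (simp add: card_image[OF inj])
    show "inv \<tau> ` J \<in> {J. J \<subseteq> UNIV \<and> card J = i}" if "J \<in> {J. J \<subseteq> UNIV \<and> card J = i}" for J
      using that card_image[OF inj_on_subset[OF bij_is_inj[OF bij_imp_bij_inv[OF assms]] subset_UNIV]]
      by auto
  qed
  then show ?thesis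
    by (simp add: m_fun_def)
qed

text \<open>A permutation of the coordinates carries any vertex to a vertex of the form \<open>x\<^sup>k\<close>.\<close>

lemma m_fun_vertex:
  fixes S :: "'n::{finite, linorder} set"
  shows "m_fun c (\<chi> j. if j \<in> S then u else l) = m_fun c (xk l u (card S) :: (real, 'n) vec)"
proof -
  let ?F = "first_indices (card S) :: 'n set"
  have card: "card ?F = card S"
    by (simp add: card_first_indices card_mono)
  then obtain f where f: "bij_betw f S ?F"
    by (metis finite finite_same_card_bij)
  have "card (- S) = card (- ?F)"
    by (simp add: Compl_eq_Diff_UNIV card_Diff_subset card)
  then obtain g where g: "bij_betw g (- S) (- ?F)"
    by (metis finite finite_same_card_bij)
  define \<tau> where "\<tau> j = (if j \<in> S then f j else g j)" for j
  have "bij_betw \<tau> (S \<union> - S) (?F \<union> - ?F)"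
    unfolding \<tau>_def by (rule bij_betw_disjoint_Un[OF f g]) auto
  then have "bij \<tau>"
    by simp
  moreover have "\<tau> j \<in> ?F \<longleftrightarrow> j \<in> S" for j
    using bij_betwE[OF f] bij_betwE[OF g] by (auto simp: \<tau>_def)
  ultimately show ?thesis
    using m_fun_permute[of \<tau> c "xk l u (card S)"] by (simp add: xk_def)
qed

lemma inner_vertex:
  fixes \<alpha> :: "real ^ 'n"
  shows "\<alpha> \<bullet> (\<chi> j. if j \<in> S then u else l) = u * (\<Sum>j\<in>S. \<alpha> $ j) + l * (\<Sum>j\<in>- S. \<alpha> $ j)"
proof -
  have "\<alpha> \<bullet> (\<chi> j. if j \<in> S then u else l) = (\<Sum>j\<in>UNIV. if j \<in> S then u * \<alpha> $ j else l * \<alpha> $ j)"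
    by (auto simp: inner_vec_def intro!: sum.cong)
  also have "\<dots> = (\<Sum>j\<in>S. u * \<alpha> $ j) + (\<Sum>j\<in>- S. l * \<alpha> $ j)"
    by (subst sum.If_cases) auto
  finally show ?thesis
    by (simp add: sum_distrib_left)
qed

section \<open>Maximizing over the convex hull\<close>

lemma linear_le_on_convex_hull:
  assumes "\<And>p. p \<in> A \<Longrightarrow> a \<bullet> p \<le> v" and "p \<in> convex hull A"
  shows "a \<bullet> p \<le> v"
proof -
  have "convex hull A \<subseteq> {p. a \<bullet> p \<le> v}"
    using assms(1) by (intro hull_minimal convex_halfspace_le) auto
  with assms(2) show ?thesis by blast
qed

theorem proposition2p3:
  fixes l u :: real
    and c :: "nat \<Rightarrow> real"
    and \<alpha> :: "real ^ 'n :: {finite, linorder}"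
    and \<alpha>' :: real
    and \<sigma> :: "'n \<Rightarrow> 'n"
  assumes "CARD('n) \<ge> 2"
    and "l < u"
    and "\<sigma> permutes UNIV"
    and "\<And>i j. i \<le> j \<Longrightarrow> \<alpha> $ \<sigma> i \<ge> \<alpha> $ \<sigma> j"
  shows "is_maximum
    ((\<lambda>(x, y). \<alpha> \<bullet> x + \<alpha>' * y) ` (convex hull (graph_set l u c)))
    (Max ((\<lambda>k. u * (\<Sum>j\<in>first_indices k. \<alpha> $ \<sigma> j)
             + l * (\<Sum>j\<in>- first_indices k. \<alpha> $ \<sigma> j)
             + \<alpha>' * m_fun c (xk l u k :: (real, 'n) vec)) ` {0..CARD('n)}))"
proof -
  let ?V = "\<lambda>S::'n set. (\<chi> j. if j \<in> S then u else l) :: (real, 'n) vec"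
  let ?F = "\<lambda>x::(real, 'n) vec. \<alpha> \<bullet> x + \<alpha>' * m_fun c x"
  define val where "val k = u * (\<Sum>j\<in>first_indices k. \<alpha> $ \<sigma> j)
      + l * (\<Sum>j\<in>- first_indices k. \<alpha> $ \<sigma> j) + \<alpha>' * m_fun c (xk l u k :: (real, 'n) vec)" for k
  define v where "v = Max (val ` {0..CARD('n)})"
  have bij: "bij \<sigma>"
    using assms(3) by (rule permutes_bij)
  then have inj: "inj_on \<sigma> T" for T
    by (auto simp: bij_def intro: inj_on_subset)
  \<comment> \<open>Vertices are described by the positions \<open>T\<close> of their large entries in the sorted order.\<close>
  have vertex: "?F (?V (\<sigma> ` T)) = u * (\<Sum>j\<in>T. \<alpha> $ \<sigma> j) + l * (\<Sum>j\<in>- T. \<alpha> $ \<sigma> j)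
      + \<alpha>' * m_fun c (xk l u (card T) :: (real, 'n) vec)" for T
  proof -
    have "- \<sigma> ` T = \<sigma> ` (- T)"
      using bij by (simp add: bij_image_Compl_eq)
    then show ?thesis
      by (simp add: inner_vertex m_fun_vertex sum.reindex[OF inj] card_image[OF inj])
  qed
  have vertex_le: "?F (?V S) \<le> v" for S
  proof -
    obtain T where S: "S = \<sigma> ` T"
      using bij by (metis bij_is_surj surj_image_vimage_eq)
    let ?I = "first_indices (card T) :: 'n set"
    have split: "(\<Sum>j\<in>- R. \<alpha> $ \<sigma> j) = (\<Sum>j\<in>UNIV. \<alpha> $ \<sigma> j) - (\<Sum>j\<in>R. \<alpha> $ \<sigma> j)" for R
      by (simp add: Compl_eq_Diff_UNIV sum_diff)
    have "(u - l) * (\<Sum>j\<in>T. \<alpha> $ \<sigma> j) \<le> (u - l) * (\<Sum>j\<in>?I. \<alpha> $ \<sigma> j)"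
      using assms(2,4) sum_le_sum_first_indices[of "\<lambda>j. \<alpha> $ \<sigma> j" T]
      by (intro mult_left_mono) auto
    then have "?F (?V S) \<le> val (card T)"
      unfolding S vertex val_def split by (simp add: algebra_simps)
    also have "\<dots> \<le> v"
      unfolding v_def by (rule Max_ge) (auto intro!: imageI card_mono)
    finally show ?thesis .
  qed
  have box_le: "?F x \<le> v" if x: "x \<in> box_set l u" for x
  proof -
    have "multiaffine ?F"
      by (intro multiaffine_add multiaffine_inner multiaffine_cmult multiaffine_m_fun)
    then obtain S where "?F x \<le> ?F (?V S)"
      using x by (rule multiaffine_le_vertex)
    then show ?thesis
      using vertex_le by (rule order_trans)
  qed
  have upper: "\<alpha> \<bullet> x + \<alpha>' * y \<le> v" if "(x, y) \<in> convex hull (graph_set l u c)" for x y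
  proof -
    have "(\<alpha>, \<alpha>') \<bullet> (x, y) \<le> v"
    proof (rule linear_le_on_convex_hull[OF _ that])
      show "(\<alpha>, \<alpha>') \<bullet> p \<le> v" if "p \<in> graph_set l u c" for p
        using that box_le by (auto simp: graph_set_def)
    qed
    then show ?thesis by simp
  qed
  have "v \<in> val ` {0..CARD('n)}"
    unfolding v_def by (rule Max_in) auto
  then obtain k where k: "k \<le> CARD('n)" "v = val k"
    by auto
  define x where "x = ?V (\<sigma> ` first_indices k)"
  have "v = ?F x"
    unfolding x_def vertex by (simp add: card_first_indices k val_def)
  moreover have "(x, m_fun c x) \<in> convex hull (graph_set l u c)"
    using assms(2) by (intro hull_inc) (auto simp: x_def graph_set_def box_set_def)
  ultimately have "v \<in> (\<lambda>(x, y). \<alpha> \<bullet> x + \<alpha>' * y) ` (convex hull (graph_set l u c))"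
    by (intro image_eqI[of _ _ "(x, m_fun c x)"]) auto
  then have "is_maximum ((\<lambda>(x, y). \<alpha> \<bullet> x + \<alpha>' * y) ` (convex hull (graph_set l u c))) v"
    using upper by (auto simp: is_maximum_def)
  then show ?thesis
    unfolding v_def val_def .
qed

end
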